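(* Let $G$ be a group, regarded as a monoid in the category of sets with the cartesian product. (1) Braided structures on $G$ correspond to matched pairs of $G$ with itself. The Yang-Baxter operator defined by a matched pair $\alpha,\beta:G\times G\to G$ has the form $$R(f,g)=(\alpha(f,g),\beta(f,g)).$$ (2) A quasi-commutative structure on $G$ corresponds to a group $K$ with $G$ acting on it by group automorphisms and a 1-cocycle $\phi:G\to K$ which is bijective as a set-theoretic map, so that the Yang-Baxter operator has the form $$R(f,g)=(fg\,\psi(f,g)^{-1},\ \psi(f,g)),\qquad\text{where } \psi(f,g)=\phi^{-1}\big(\phi(f)^{g}\big).$$ (3) The Yang-Baxter operator in (2) is involutive (i.e. the quasi-commutative structure is nearly commutative) if and only if the group $K$ is abelian.
   Context: Let $\mu:G\times G\to G$ be the multiplication and $\iota:\{*\}\to G$ the unit of $G$; $I$ denotes an identity map and composition is written right to left. A Yang-Baxter operator on $G$ is a bijection $R:G\times G\to G\times G$ with $(R\times I)(I\times R)(R\times I)=(I\times R)(R\times I)(I\times R)$. A braided structure on $G$ is a Yang-Baxter operator $R$ on $G$ such that $R(\iota\times I)=I\times\iota$, $R(I\times\iota)=\iota\times I$, $R(I\times\mu)=(\mu\times I)(I\times R)(R\times I)$, and $R(\mu\times I)=(I\times\mu)(R\times I)(I\times R)$. It is a quasi-commutative structure if in addition $\mu R=\mu$, and a quasi-commutative structure is nearly commutative if $R^2=I$. A matched pair of groups $F,H$ is a group $P$ which can be written as a product $FH$ of its subgroups $F$ and $H$, each element of $P$ being uniquely of the form $fh$ with $f\in F$, $h\in H$. The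 multiplication in $P$ then defines two functions $\alpha:H\times F\to F$, $\beta:H\times F\to H$ such that $hf=\alpha(h,f)\beta(h,f)$. A matched pair of $G$ with itself is the case where both $F$ and $H$ are copies of $G$ (embedded in $P$ by two possibly different injective homomorphisms), so that $\alpha,\beta:G\times G\to G$. For a group $K$ on which $G$ acts from the right by group automorphisms, $(u,g)\mapsto u^g$, a 1-cocycle of $G$ with coefficients in $K$ is a map $\phi:G\to K$ such that $\phi(fg)=\phi(f)^g\phi(g)$ for all $f,g\in G$.
   Formalization: In (1) a matched pair need not give a Yang-Baxter operator (e.g. a semidirect product on the Klein four-group); proved: R is always bijective with the four unit/multiplication identities, and braided structures correspond to matched pairs (up to isomorphism) whose R satisfies Yang-Baxter. *)

theory Defs
  imports "HOL-Algebra.Algebra"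
begin

text \<open>
  Triples are nested to the right, \<open>(x, y, z) = (x, (y, z))\<close>.  Operators on \<open>A \<times> A\<close> are
  extensional functions, so that equality of operators is equality of HOL functions.
\<close>

definition on12 :: "('a \<times> 'a \<Rightarrow> 'a \<times> 'a) \<Rightarrow> 'a \<times> 'a \<times> 'a \<Rightarrow> 'a \<times> 'a \<times> 'a" where
  "on12 R = (\<lambda>(x, y, z). (fst (R (x, y)), snd (R (x, y)), z))"

definition on23 :: "('a \<times> 'a \<Rightarrow> 'a \<times> 'a) \<Rightarrow> 'a \<times> 'a \<times> 'a \<Rightarrow> 'a \<times> 'a \<times> 'a" where
  "on23 R = (\<lambda>(x, y, z). (x, R (y, z)))"

definition mult12 :: "('a, 'b) monoid_scheme \<Rightarrow> 'a \<times> 'a \<times> 'a \<Rightarrow> 'a \<times> 'a" where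
  "mult12 G = (\<lambda>(x, y, z). (x \<otimes>\<^bsub>G\<^esub> y, z))"

definition mult23 :: "('a, 'b) monoid_scheme \<Rightarrow> 'a \<times> 'a \<times> 'a \<Rightarrow> 'a \<times> 'a" where
  "mult23 G = (\<lambda>(x, y, z). (x, y \<otimes>\<^bsub>G\<^esub> z))"

definition yang_baxter_equation :: "'a set \<Rightarrow> ('a \<times> 'a \<Rightarrow> 'a \<times> 'a) \<Rightarrow> bool" where
  "yang_baxter_equation A R \<longleftrightarrow>
     (\<forall>t \<in> A \<times> A \<times> A. on12 R (on23 R (on12 R t)) = on23 R (on12 R (on23 R t)))"

definition yang_baxter_operator :: "'a set \<Rightarrow> ('a \<times> 'a \<Rightarrow> 'a \<times> 'a) \<Rightarrow> bool" where
  "yang_baxter_operator A R \<longleftrightarrow>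
     R \<in> extensional (A \<times> A) \<and> bij_betw R (A \<times> A) (A \<times> A) \<and> yang_baxter_equation A R"

definition braiding_identities ::
  "('a, 'b) monoid_scheme \<Rightarrow> ('a \<times> 'a \<Rightarrow> 'a \<times> 'a) \<Rightarrow> bool" where
  "braiding_identities G R \<longleftrightarrow>
     (\<forall>x \<in> carrier G. R (\<one>\<^bsub>G\<^esub>, x) = (x, \<one>\<^bsub>G\<^esub>) \<and> R (x, \<one>\<^bsub>G\<^esub>) = (\<one>\<^bsub>G\<^esub>, x)) \<and>
     (\<forall>t \<in> carrier G \<times> carrier G \<times> carrier G.
        R (mult23 G t) = mult12 G (on23 R (on12 R t)) \<and>
        R (mult12 G t) = mult23 G (on12 R (on23 R t)))"

definition braided_structure ::
  "('a, 'b) monoid_scheme \<Rightarrow> ('a \<times> 'a \<Rightarrow> 'a \<times> 'a) \<Rightarrow> bool" where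
  "braided_structure G R \<longleftrightarrow> yang_baxter_operator (carrier G) R \<and> braiding_identities G R"

definition quasi_commutative_structure ::
  "('a, 'b) monoid_scheme \<Rightarrow> ('a \<times> 'a \<Rightarrow> 'a \<times> 'a) \<Rightarrow> bool" where
  "quasi_commutative_structure G R \<longleftrightarrow> braided_structure G R \<and>
     (\<forall>x \<in> carrier G. \<forall>y \<in> carrier G. fst (R (x, y)) \<otimes>\<^bsub>G\<^esub> snd (R (x, y)) = x \<otimes>\<^bsub>G\<^esub> y)"

definition involutive_operator :: "'a set \<Rightarrow> ('a \<times> 'a \<Rightarrow> 'a \<times> 'a) \<Rightarrow> bool" where
  "involutive_operator A R \<longleftrightarrow> (\<forall>p \<in> A \<times> A. R (R p) = p)"

definition nearly_commutative_structure ::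
  "('a, 'b) monoid_scheme \<Rightarrow> ('a \<times> 'a \<Rightarrow> 'a \<times> 'a) \<Rightarrow> bool" where
  "nearly_commutative_structure G R \<longleftrightarrow>
     quasi_commutative_structure G R \<and> involutive_operator (carrier G) R"


definition matched_pair :: "('p, 'b) monoid_scheme \<Rightarrow> 'p set \<Rightarrow> 'p set \<Rightarrow> bool" where
  "matched_pair P F H \<longleftrightarrow> group P \<and> subgroup F P \<and> subgroup H P \<and>
     (\<forall>x \<in> carrier P. \<exists>!p. p \<in> F \<times> H \<and> x = fst p \<otimes>\<^bsub>P\<^esub> snd p)"

definition factorization :: "('p, 'b) monoid_scheme \<Rightarrow> 'p set \<Rightarrow> 'p set \<Rightarrow> 'p \<Rightarrow> 'p \<times> 'p" where
  "factorization P F H x = (THE p. p \<in> F \<times> H \<and> x = fst p \<otimes>\<^bsub>P\<^esub> snd p)"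

text \<open>The two maps with \<open>h f = \<alpha>(h, f) \<beta>(h, f)\<close>, for \<open>h \<in> H\<close> and \<open>f \<in> F\<close>.\<close>

definition mp_alpha :: "('p, 'b) monoid_scheme \<Rightarrow> 'p set \<Rightarrow> 'p set \<Rightarrow> 'p \<Rightarrow> 'p \<Rightarrow> 'p" where
  "mp_alpha P F H h f = fst (factorization P F H (h \<otimes>\<^bsub>P\<^esub> f))"

definition mp_beta :: "('p, 'b) monoid_scheme \<Rightarrow> 'p set \<Rightarrow> 'p set \<Rightarrow> 'p \<Rightarrow> 'p \<Rightarrow> 'p" where
  "mp_beta P F H h f = snd (factorization P F H (h \<otimes>\<^bsub>P\<^esub> f))"

text \<open>
  A matched pair of \<open>G\<close> with itself: \<open>i\<close> embeds \<open>G\<close> as the left factor \<open>F\<close>, and \<open>j\<close> embeds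
  \<open>G\<close> as the right factor \<open>H\<close>.
\<close>

definition self_matched_pair ::
  "('a, 'b) monoid_scheme \<Rightarrow> ('p, 'c) monoid_scheme \<Rightarrow> ('a \<Rightarrow> 'p) \<Rightarrow> ('a \<Rightarrow> 'p) \<Rightarrow> bool" where
  "self_matched_pair G P i j \<longleftrightarrow>
     i \<in> hom G P \<and> inj_on i (carrier G) \<and> j \<in> hom G P \<and> inj_on j (carrier G) \<and>
     matched_pair P (i ` carrier G) (j ` carrier G)"

text \<open>The maps \<open>\<alpha>, \<beta>\<close> transported to \<open>G\<close>; their first argument lives in the copy \<open>j ` carrier G\<close>.\<close>

definition self_alpha ::
  "('a, 'b) monoid_scheme \<Rightarrow> ('p, 'c) monoid_scheme \<Rightarrow> ('a \<Rightarrow> 'p) \<Rightarrow> ('a \<Rightarrow> 'p) \<Rightarrow> 'a \<Rightarrow> 'a \<Rightarrow> 'a" where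
  "self_alpha G P i j f g =
     inv_into (carrier G) i (mp_alpha P (i ` carrier G) (j ` carrier G) (j f) (i g))"

definition self_beta ::
  "('a, 'b) monoid_scheme \<Rightarrow> ('p, 'c) monoid_scheme \<Rightarrow> ('a \<Rightarrow> 'p) \<Rightarrow> ('a \<Rightarrow> 'p) \<Rightarrow> 'a \<Rightarrow> 'a \<Rightarrow> 'a" where
  "self_beta G P i j f g =
     inv_into (carrier G) j (mp_beta P (i ` carrier G) (j ` carrier G) (j f) (i g))"

text \<open>
  This operator need not satisfy the Yang-Baxter equation.  Let \<open>G\<close> act on itself by
  automorphisms \<open>\<rho>\<close>; the semidirect product gives \<open>R(f, g) = (\<rho> f g, f)\<close>, for which the equation
  says \<open>\<rho> (\<rho> f g) \<circ> \<rho> f = \<rho> f \<circ> \<rho> g\<close>.  It fails for the Klein four-group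
  \<open>{0, 1} \<times> {0, 1}\<close> when \<open>\<rho> (x, y)\<close> is the \<open>x\<close>-th power of the exchange of coordinates.
\<close>

definition matched_pair_operator ::
  "('a, 'b) monoid_scheme \<Rightarrow> ('p, 'c) monoid_scheme \<Rightarrow> ('a \<Rightarrow> 'p) \<Rightarrow> ('a \<Rightarrow> 'p) \<Rightarrow>
   'a \<times> 'a \<Rightarrow> 'a \<times> 'a" where
  "matched_pair_operator G P i j =
     (\<lambda>(f, g) \<in> carrier G \<times> carrier G. (self_alpha G P i j f g, self_beta G P i j f g))"

definition self_matched_pair_iso ::
  "('a, 'b) monoid_scheme \<Rightarrow> ('p, 'c) monoid_scheme \<Rightarrow> ('a \<Rightarrow> 'p) \<Rightarrow> ('a \<Rightarrow> 'p) \<Rightarrow>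
   ('q, 'd) monoid_scheme \<Rightarrow> ('a \<Rightarrow> 'q) \<Rightarrow> ('a \<Rightarrow> 'q) \<Rightarrow> bool" where
  "self_matched_pair_iso G P i j Q k l \<longleftrightarrow>
     (\<exists>\<theta> \<in> iso P Q. \<forall>g \<in> carrier G. \<theta> (i g) = k g \<and> \<theta> (j g) = l g)"


definition right_automorphism_action ::
  "('a, 'b) monoid_scheme \<Rightarrow> ('k, 'c) monoid_scheme \<Rightarrow> ('k \<Rightarrow> 'a \<Rightarrow> 'k) \<Rightarrow> bool" where
  "right_automorphism_action G K act \<longleftrightarrow>
     (\<forall>g \<in> carrier G. (\<lambda>u. act u g) \<in> iso K K) \<and>
     (\<forall>u \<in> carrier K. act u \<one>\<^bsub>G\<^esub> = u) \<and>
     (\<forall>u \<in> carrier K. \<forall>f \<in> carrier G. \<forall>g \<in> carrier G. act u (f \<otimes>\<^bsub>G\<^esub> g) = act (act u f) g)"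

definition one_cocycle ::
  "('a, 'b) monoid_scheme \<Rightarrow> ('k, 'c) monoid_scheme \<Rightarrow> ('k \<Rightarrow> 'a \<Rightarrow> 'k) \<Rightarrow> ('a \<Rightarrow> 'k) \<Rightarrow> bool" where
  "one_cocycle G K act \<phi> \<longleftrightarrow> \<phi> \<in> carrier G \<rightarrow> carrier K \<and>
     (\<forall>f \<in> carrier G. \<forall>g \<in> carrier G. \<phi> (f \<otimes>\<^bsub>G\<^esub> g) = act (\<phi> f) g \<otimes>\<^bsub>K\<^esub> \<phi> g)"

definition bijective_cocycle ::
  "('a, 'b) monoid_scheme \<Rightarrow> ('k, 'c) monoid_scheme \<Rightarrow> ('k \<Rightarrow> 'a \<Rightarrow> 'k) \<Rightarrow> ('a \<Rightarrow> 'k) \<Rightarrow> bool" where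
  "bijective_cocycle G K act \<phi> \<longleftrightarrow>
     group K \<and> right_automorphism_action G K act \<and> one_cocycle G K act \<phi> \<and>
     bij_betw \<phi> (carrier G) (carrier K)"

definition cocycle_psi ::
  "('a, 'b) monoid_scheme \<Rightarrow> ('k \<Rightarrow> 'a \<Rightarrow> 'k) \<Rightarrow> ('a \<Rightarrow> 'k) \<Rightarrow> 'a \<Rightarrow> 'a \<Rightarrow> 'a" where
  "cocycle_psi G act \<phi> f g = inv_into (carrier G) \<phi> (act (\<phi> f) g)"

definition cocycle_operator ::
  "('a, 'b) monoid_scheme \<Rightarrow> ('k \<Rightarrow> 'a \<Rightarrow> 'k) \<Rightarrow> ('a \<Rightarrow> 'k) \<Rightarrow> 'a \<times> 'a \<Rightarrow> 'a \<times> 'a" where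
  "cocycle_operator G act \<phi> =
     (\<lambda>(f, g) \<in> carrier G \<times> carrier G.
        (f \<otimes>\<^bsub>G\<^esub> g \<otimes>\<^bsub>G\<^esub> inv\<^bsub>G\<^esub> (cocycle_psi G act \<phi> f g), cocycle_psi G act \<phi> f g))"

definition cocycle_iso ::
  "('a, 'b) monoid_scheme \<Rightarrow>
   ('k, 'c) monoid_scheme \<Rightarrow> ('k \<Rightarrow> 'a \<Rightarrow> 'k) \<Rightarrow> ('a \<Rightarrow> 'k) \<Rightarrow>
   ('l, 'd) monoid_scheme \<Rightarrow> ('l \<Rightarrow> 'a \<Rightarrow> 'l) \<Rightarrow> ('a \<Rightarrow> 'l) \<Rightarrow> bool" where
  "cocycle_iso G K act \<phi> L act' \<phi>' \<longleftrightarrow>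
     (\<exists>\<theta> \<in> iso K L.
        (\<forall>u \<in> carrier K. \<forall>g \<in> carrier G. \<theta> (act u g) = act' (\<theta> u) g) \<and>
        (\<forall>g \<in> carrier G. \<theta> (\<phi> g) = \<phi>' g))"

end

theory Submission
  imports Defs
begin

text \<open>
  The braiding identities for \<open>R(x, y) = (a x y, b x y)\<close> say exactly that the exchange rule
  \<open>j x i y = i (a x y) j (b x y)\<close> makes \<open>G \<times> G\<close> a group with factors \<open>i G\<close> and \<open>j G\<close>;
  such an \<open>R\<close> is bijective because \<open>P = F H\<close> implies \<open>P = H F\<close>, by inversion.
  If moreover \<open>\<mu> R = \<mu>\<close>, then \<open>R\<close> is determined by the right action \<open>b\<close> of \<open>G\<close> on the set \<open>G\<close>.
  The law for \<open>b (x y) z\<close> says that this action is by automorphisms of the multiplication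
  \<open>u * v = b u (v\<^sup>-\<^sup>1) v\<close>, which is the one that turns the identity map into a cocycle.
\<close>

section \<open>Matched pairs of a group with itself\<close>

locale matched_group = group G for G (structure) +
  fixes P :: "('p, 'c) monoid_scheme" and i j
  assumes matched: "self_matched_pair G P i j"
begin

abbreviation "al \<equiv> self_alpha G P i j"
abbreviation "be \<equiv> self_beta G P i j"

sublocale P: group P
  using matched by (simp add: self_matched_pair_def matched_pair_def)

sublocale i: group_hom G P i
  using matched by (unfold_locales) (simp add: self_matched_pair_def)

sublocale j: group_hom G P j
  using matched by (unfold_locales) (simp add: self_matched_pair_def)

lemma ex1_factor:
  assumes "x \<in> carrier P"
  shows "\<exists>!p. p \<in> i ` carrier G \<times> j ` carrier G \<and> x = fst p \<otimes>\<^bsub>P\<^esub> snd p"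
  using matched assms by (simp add: self_matched_pair_def matched_pair_def)

lemma inj_i: "inj_on i (carrier G)" and inj_j: "inj_on j (carrier G)"
  using matched by (simp_all add: self_matched_pair_def)

lemma ex_factor:
  assumes "x \<in> carrier P"
  obtains a b where "a \<in> carrier G" "b \<in> carrier G" "x = i a \<otimes>\<^bsub>P\<^esub> j b"
  using ex1_implies_ex[OF ex1_factor[OF assms]] by fastforce

lemma factor_unique:
  assumes "a \<in> carrier G" "b \<in> carrier G" "c \<in> carrier G" "d \<in> carrier G"
    and eq: "i a \<otimes>\<^bsub>P\<^esub> j b = i c \<otimes>\<^bsub>P\<^esub> j d"
  shows "a = c" "b = d"
proof -
  have "i a \<otimes>\<^bsub>P\<^esub> j b \<in> carrier P" using assms by simp
  from ex1_factor[OF this] have "(i a, j b) = (i c, j d)"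
    by (rule ex1E) (metis assms(1-4) eq fst_conv snd_conv imageI mem_Sigma_iff)
  then show "a = c" "b = d"
    using inj_i inj_j assms(1-4) by (auto simp: inj_on_eq_iff)
qed

text \<open>By \<open>ex1_factor\<close> the definite description in \<open>factorization\<close>
  denotes an actual pair, and on the images of \<open>i\<close> and \<open>j\<close> the maps
  \<open>inv_into\<close> are genuine inverses.\<close>

lemma exchange:
  assumes f: "f \<in> carrier G" and g: "g \<in> carrier G"
  shows al_closed: "al f g \<in> carrier G"
    and be_closed: "be f g \<in> carrier G"
    and exchange_eq: "j f \<otimes>\<^bsub>P\<^esub> i g = i (al f g) \<otimes>\<^bsub>P\<^esub> j (be f g)"
proof -
  let ?q = "factorization P (i ` carrier G) (j ` carrier G) (j f \<otimes>\<^bsub>P\<^esub> i g)"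
  have "j f \<otimes>\<^bsub>P\<^esub> i g \<in> carrier P" using f g by simp
  from theI'[OF ex1_factor[OF this]]
  have q: "fst ?q \<in> i ` carrier G" "snd ?q \<in> j ` carrier G"
    "j f \<otimes>\<^bsub>P\<^esub> i g = fst ?q \<otimes>\<^bsub>P\<^esub> snd ?q"
    by (auto simp: factorization_def mem_Times_iff)
  show "al f g \<in> carrier G" "be f g \<in> carrier G"
    using q by (simp_all add: self_alpha_def self_beta_def mp_alpha_def mp_beta_def inv_into_into)
  show "j f \<otimes>\<^bsub>P\<^esub> i g = i (al f g) \<otimes>\<^bsub>P\<^esub> j (be f g)"
    using q by (simp add: self_alpha_def self_beta_def mp_alpha_def mp_beta_def f_inv_into_f)
qed

text \<open>Factorizations are unique, so \<open>al\<close> and \<open>be\<close> can be read off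
  from any way of writing \<open>j f i g\<close> with the factor from \<open>i\<close> on the left.
  The braiding identities are proved in this way.\<close>

lemma exchange_eqI:
  assumes "f \<in> carrier G" "g \<in> carrier G" "a \<in> carrier G" "b \<in> carrier G"
    and "j f \<otimes>\<^bsub>P\<^esub> i g = i a \<otimes>\<^bsub>P\<^esub> j b"
  shows "al f g = a" "be f g = b"
  using factor_unique[of "al f g" "be f g" a b] assms exchange[of f g] by auto

lemma operator_apply:
  "f \<in> carrier G \<Longrightarrow> g \<in> carrier G \<Longrightarrow> matched_pair_operator G P i j (f, g) = (al f g, be f g)"
  by (simp add: matched_pair_operator_def)

text \<open>Associativity in \<open>P\<close>: the products \<open>j x i y i z\<close> and
  \<open>j x j y i z\<close> are brought into the form \<open>i _ j _\<close> once by a single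
  exchange and once by two successive ones, and the results are compared.\<close>

lemma operator_braiding: "braiding_identities G (matched_pair_operator G P i j)"
proof -
  have 1: "al \<one> x = x \<and> be \<one> x = \<one>" if "x \<in> carrier G" for x
    using exchange_eqI[of \<one> x x \<one>] that by simp
  have 2: "al x \<one> = \<one> \<and> be x \<one> = x" if "x \<in> carrier G" for x
    using exchange_eqI[of x \<one> \<one> x] that by simp
  have 3: "al x (y \<otimes> z) = al x y \<otimes> al (be x y) z \<and> be x (y \<otimes> z) = be (be x y) z"
    if [simp]: "x \<in> carrier G" "y \<in> carrier G" "z \<in> carrier G" for x y z
  proof -
    note [simp] = exchange(1,2)
    have "j x \<otimes>\<^bsub>P\<^esub> i (y \<otimes> z) = (j x \<otimes>\<^bsub>P\<^esub> i y) \<otimes>\<^bsub>P\<^esub> i z"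
      by (simp add: P.m_assoc)
    also have "\<dots> = i (al x y) \<otimes>\<^bsub>P\<^esub> (j (be x y) \<otimes>\<^bsub>P\<^esub> i z)"
      by (simp add: exchange_eq[of x y] P.m_assoc)
    also have "\<dots> = i (al x y \<otimes> al (be x y) z) \<otimes>\<^bsub>P\<^esub> j (be (be x y) z)"
      by (simp add: exchange_eq[of "be x y" z] P.m_assoc)
    finally have "j x \<otimes>\<^bsub>P\<^esub> i (y \<otimes> z) =
      i (al x y \<otimes> al (be x y) z) \<otimes>\<^bsub>P\<^esub> j (be (be x y) z)" .
    from exchange_eqI[OF _ _ _ _ this] show ?thesis by simp
  qed
  have 4: "al (x \<otimes> y) z = al x (al y z) \<and> be (x \<otimes> y) z = be x (al y z) \<otimes> be y z"
    if [simp]: "x \<in> carrier G" "y \<in> carrier G" "z \<in> carrier G" for x y z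
  proof -
    note [simp] = exchange(1,2)
    have "j (x \<otimes> y) \<otimes>\<^bsub>P\<^esub> i z = j x \<otimes>\<^bsub>P\<^esub> (j y \<otimes>\<^bsub>P\<^esub> i z)"
      by (simp add: P.m_assoc)
    also have "\<dots> = (j x \<otimes>\<^bsub>P\<^esub> i (al y z)) \<otimes>\<^bsub>P\<^esub> j (be y z)"
      by (simp add: exchange_eq[of y z] P.m_assoc)
    also have "\<dots> = i (al x (al y z)) \<otimes>\<^bsub>P\<^esub> j (be x (al y z) \<otimes> be y z)"
      by (simp add: exchange_eq[of x "al y z"] P.m_assoc)
    finally have "j (x \<otimes> y) \<otimes>\<^bsub>P\<^esub> i z =
      i (al x (al y z)) \<otimes>\<^bsub>P\<^esub> j (be x (al y z) \<otimes> be y z)" .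
    from exchange_eqI[OF _ _ _ _ this] show ?thesis by simp
  qed
  show ?thesis
    using 1 2 3 4 by (auto simp: braiding_identities_def mult12_def mult23_def on12_def on23_def
        operator_apply exchange(1,2))
qed

lemma operator_bij:
  "bij_betw (matched_pair_operator G P i j) (carrier G \<times> carrier G) (carrier G \<times> carrier G)"
  unfolding bij_betw_def
proof
  let ?R = "matched_pair_operator G P i j"
  show "inj_on ?R (carrier G \<times> carrier G)"
  proof (rule inj_onI, clarify)
    fix f g f' g'
    assume [simp]: "f \<in> carrier G" "g \<in> carrier G" "f' \<in> carrier G" "g' \<in> carrier G"
      and "?R (f, g) = ?R (f', g')"
    then have "j f \<otimes>\<^bsub>P\<^esub> i g = j f' \<otimes>\<^bsub>P\<^esub> i g'"
      by (simp add: operator_apply exchange_eq)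
    \<comment> \<open>Inversion moves the factor from \<open>i\<close> to the left, where uniqueness
      of factorization applies.\<close>
    then have "inv\<^bsub>P\<^esub> (j f \<otimes>\<^bsub>P\<^esub> i g) = inv\<^bsub>P\<^esub> (j f' \<otimes>\<^bsub>P\<^esub> i g')" by simp
    then have "i (inv g) \<otimes>\<^bsub>P\<^esub> j (inv f) = i (inv g') \<otimes>\<^bsub>P\<^esub> j (inv f')"
      by (simp add: P.inv_mult_group)
    from factor_unique[OF _ _ _ _ this] have "inv g = inv g'" "inv f = inv f'"
      by simp_all
    then show "f = f' \<and> g = g'" by (metis \<open>f \<in> _\<close> \<open>g \<in> _\<close> \<open>f' \<in> _\<close> \<open>g' \<in> _\<close> inv_inv)
  qed
  show "?R ` (carrier G \<times> carrier G) = carrier G \<times> carrier G"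
  proof
    show "?R ` (carrier G \<times> carrier G) \<subseteq> carrier G \<times> carrier G"
      by (auto simp: operator_apply exchange(1,2))
    show "carrier G \<times> carrier G \<subseteq> ?R ` (carrier G \<times> carrier G)"
    proof clarify
      fix a b assume [simp]: "a \<in> carrier G" "b \<in> carrier G"
      \<comment> \<open>The inverse of \<open>i a j b\<close> is factored as \<open>i c j d\<close>;
        inverting back gives \<open>j (inv d) i (inv c)\<close>, hence the preimage
        \<open>(inv d, inv c)\<close>.\<close>
      obtain c d where [simp]: "c \<in> carrier G" "d \<in> carrier G"
        and cd: "inv\<^bsub>P\<^esub> (i a \<otimes>\<^bsub>P\<^esub> j b) = i c \<otimes>\<^bsub>P\<^esub> j d"
        using ex_factor[of "inv\<^bsub>P\<^esub> (i a \<otimes>\<^bsub>P\<^esub> j b)"] by auto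
      have "i a \<otimes>\<^bsub>P\<^esub> j b = inv\<^bsub>P\<^esub> (i c \<otimes>\<^bsub>P\<^esub> j d)"
        by (simp flip: cd)
      also have "\<dots> = j (inv d) \<otimes>\<^bsub>P\<^esub> i (inv c)"
        by (simp add: P.inv_mult_group)
      finally have "?R (inv d, inv c) = (a, b)"
        using exchange_eqI[of "inv d" "inv c" a b] by (simp add: operator_apply)
      then show "(a, b) \<in> ?R ` (carrier G \<times> carrier G)"
        by (metis SigmaI \<open>c \<in> _\<close> \<open>d \<in> _\<close> image_eqI inv_closed)
    qed
  qed
qed

lemma operator_braided_iff:
  "braided_structure G (matched_pair_operator G P i j) \<longleftrightarrow>
   yang_baxter_equation (carrier G) (matched_pair_operator G P i j)"
  using operator_bij operator_braiding
  by (simp add: braided_structure_def yang_baxter_operator_def matched_pair_operator_def)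

end

section \<open>Isomorphisms of matched pairs\<close>

text \<open>The exchange rule fixes how elements \<open>i a j b\<close> are multiplied, so equal
  operators make \<open>i a j b \<mapsto> k a l b\<close> an isomorphism.\<close>

lemma self_matched_pair_isoI:
  assumes "group G" "self_matched_pair G P i j" "self_matched_pair G Q k l"
    and eq: "matched_pair_operator G P i j = matched_pair_operator G Q k l"
  shows "self_matched_pair_iso G P i j Q k l"
proof -
  interpret P: matched_group G P i j
    using assms by (simp add: matched_group_def matched_group_axioms_def)
  interpret Q: matched_group G Q k l
    using assms by (simp add: matched_group_def matched_group_axioms_def)
  have ab: "P.al f g = Q.al f g" "P.be f g = Q.be f g"
    if "f \<in> carrier G" "g \<in> carrier G" for f g
    using P.operator_apply[OF that] Q.operator_apply[OF that] eq by auto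
  \<comment> \<open>Uniqueness of factorization in \<open>P\<close> leaves only one candidate for
    the choice when \<open>x\<close> lies in the carrier.\<close>
  define T where "T x = (SOME y. \<exists>a b. a \<in> carrier G \<and> b \<in> carrier G \<and>
    x = i a \<otimes>\<^bsub>P\<^esub> j b \<and> y = k a \<otimes>\<^bsub>Q\<^esub> l b)" for x
  have T: "T (i a \<otimes>\<^bsub>P\<^esub> j b) = k a \<otimes>\<^bsub>Q\<^esub> l b" if "a \<in> carrier G" "b \<in> carrier G" for a b
    unfolding T_def
  proof (rule some_equality)
    show "\<exists>a' b'. a' \<in> carrier G \<and> b' \<in> carrier G \<and>
      i a \<otimes>\<^bsub>P\<^esub> j b = i a' \<otimes>\<^bsub>P\<^esub> j b' \<and> k a \<otimes>\<^bsub>Q\<^esub> l b = k a' \<otimes>\<^bsub>Q\<^esub> l b'"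
      using that by blast
  next
    fix y assume "\<exists>a' b'. a' \<in> carrier G \<and> b' \<in> carrier G \<and>
      i a \<otimes>\<^bsub>P\<^esub> j b = i a' \<otimes>\<^bsub>P\<^esub> j b' \<and> y = k a' \<otimes>\<^bsub>Q\<^esub> l b'"
    then show "y = k a \<otimes>\<^bsub>Q\<^esub> l b"
      using P.factor_unique[OF that] by metis
  qed
  have "T \<in> hom P Q"
  proof (rule homI)
    fix x assume "x \<in> carrier P"
    then show "T x \<in> carrier Q" by (rule P.ex_factor) (simp add: T)
  next
    fix x y assume "x \<in> carrier P" "y \<in> carrier P"
    obtain a b where [simp]: "a \<in> carrier G" "b \<in> carrier G" and x: "x = i a \<otimes>\<^bsub>P\<^esub> j b"
      by (rule P.ex_factor[OF \<open>x \<in> carrier P\<close>])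
    obtain c d where [simp]: "c \<in> carrier G" "d \<in> carrier G" and y: "y = i c \<otimes>\<^bsub>P\<^esub> j d"
      by (rule P.ex_factor[OF \<open>y \<in> carrier P\<close>])
    note [simp] = Q.exchange(1,2)
    \<comment> \<open>Only the inner product \<open>j b i c\<close> has to be exchanged, and
      \<open>P\<close> and \<open>Q\<close> do this by the same two functions.\<close>
    have "x \<otimes>\<^bsub>P\<^esub> y = i a \<otimes>\<^bsub>P\<^esub> (j b \<otimes>\<^bsub>P\<^esub> i c) \<otimes>\<^bsub>P\<^esub> j d"
      by (simp add: x y P.P.m_assoc)
    also have "\<dots> = i (a \<otimes>\<^bsub>G\<^esub> Q.al b c) \<otimes>\<^bsub>P\<^esub> j (Q.be b c \<otimes>\<^bsub>G\<^esub> d)"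
      by (simp add: P.exchange_eq ab P.P.m_assoc)
    \<comment> \<open>The homomorphism laws are switched off to keep the argument in the form
      \<open>i _ j _\<close> on which \<open>T\<close> is known.\<close>
    finally have "T (x \<otimes>\<^bsub>P\<^esub> y) = k (a \<otimes>\<^bsub>G\<^esub> Q.al b c) \<otimes>\<^bsub>Q\<^esub> l (Q.be b c \<otimes>\<^bsub>G\<^esub> d)"
      by (simp add: T del: P.i.hom_mult P.j.hom_mult Q.i.hom_mult Q.j.hom_mult)
    also have "\<dots> = k a \<otimes>\<^bsub>Q\<^esub> (k (Q.al b c) \<otimes>\<^bsub>Q\<^esub> l (Q.be b c)) \<otimes>\<^bsub>Q\<^esub> l d"
      by (simp add: Q.P.m_assoc)
    also have "\<dots> = T x \<otimes>\<^bsub>Q\<^esub> T y"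
      by (simp add: x y T Q.P.m_assoc flip: Q.exchange_eq)
    finally show "T (x \<otimes>\<^bsub>P\<^esub> y) = T x \<otimes>\<^bsub>Q\<^esub> T y" .
  qed
  moreover have "bij_betw T (carrier P) (carrier Q)"
  proof (rule bij_betw_imageI)
    show "inj_on T (carrier P)"
    proof (rule inj_onI)
      fix x y assume x: "x \<in> carrier P" and y: "y \<in> carrier P" and eq: "T x = T y"
      obtain a b where ab: "a \<in> carrier G" "b \<in> carrier G" "x = i a \<otimes>\<^bsub>P\<^esub> j b"
        by (rule P.ex_factor[OF x])
      obtain c d where cd: "c \<in> carrier G" "d \<in> carrier G" "y = i c \<otimes>\<^bsub>P\<^esub> j d"
        by (rule P.ex_factor[OF y])
      have "k a \<otimes>\<^bsub>Q\<^esub> l b = k c \<otimes>\<^bsub>Q\<^esub> l d"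
        using eq by (simp only: ab cd T)
      from Q.factor_unique[OF ab(1,2) cd(1,2) this] show "x = y" by (simp add: ab cd)
    qed
    show "T ` carrier P = carrier Q"
    proof (intro equalityI subsetI)
      fix x assume "x \<in> T ` carrier P"
      then show "x \<in> carrier Q" using \<open>T \<in> hom P Q\<close> by (auto simp: hom_def)
    next
      fix x assume "x \<in> carrier Q"
      then obtain a b where [simp]: "a \<in> carrier G" "b \<in> carrier G" and "x = k a \<otimes>\<^bsub>Q\<^esub> l b"
        by (rule Q.ex_factor)
      then have "x = T (i a \<otimes>\<^bsub>P\<^esub> j b)" by (simp add: T)
      then show "x \<in> T ` carrier P" by simp
    qed
  qed
  moreover have "T (i g) = k g" "T (j g) = l g" if "g \<in> carrier G" for g
    using T[of g "\<one>\<^bsub>G\<^esub>"] T[of "\<one>\<^bsub>G\<^esub>" g] that by simp_all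
  ultimately show ?thesis
    by (auto simp: self_matched_pair_iso_def iso_def)
qed

text \<open>An isomorphism compatible with the embeddings turns the exchange rule of
  \<open>P\<close> into a factorization of \<open>l f k g\<close> in \<open>Q\<close>, and
  factorizations in \<open>Q\<close> are unique.\<close>

lemma self_matched_pair_isoD:
  assumes "group G" "self_matched_pair G P i j" "self_matched_pair G Q k l"
    and "self_matched_pair_iso G P i j Q k l"
  shows "matched_pair_operator G P i j = matched_pair_operator G Q k l"
proof -
  interpret P: matched_group G P i j
    using assms by (simp add: matched_group_def matched_group_axioms_def)
  interpret Q: matched_group G Q k l
    using assms by (simp add: matched_group_def matched_group_axioms_def)
  obtain T where T: "T \<in> hom P Q"
    and Ti: "\<And>g. g \<in> carrier G \<Longrightarrow> T (i g) = k g"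
    and Tj: "\<And>g. g \<in> carrier G \<Longrightarrow> T (j g) = l g"
    using assms(4) by (auto simp: self_matched_pair_iso_def iso_def)
  have "Q.al f g = P.al f g \<and> Q.be f g = P.be f g"
    if [simp]: "f \<in> carrier G" "g \<in> carrier G" for f g
  proof -
    note [simp] = P.exchange(1,2)
    have "T (j f \<otimes>\<^bsub>P\<^esub> i g) = T (i (P.al f g) \<otimes>\<^bsub>P\<^esub> j (P.be f g))"
      by (simp add: P.exchange_eq)
    then have "l f \<otimes>\<^bsub>Q\<^esub> k g = k (P.al f g) \<otimes>\<^bsub>Q\<^esub> l (P.be f g)"
      by (simp add: hom_mult[OF T] Ti Tj)
    from Q.exchange_eqI[OF _ _ _ _ this] show ?thesis by simp
  qed
  then show ?thesis
    by (auto simp: matched_pair_operator_def fun_eq_iff restrict_def)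
qed

section \<open>From braiding identities to the bicrossed product\<close>

text \<open>The braiding identities of \<open>R(x, y) = (a x y, b x y)\<close> in coordinates:
  \<open>a\<close> is a left action and \<open>b\<close> a right action of \<open>G\<close> on its
  own underlying set, and each is multiplicative up to a twist by the other.\<close>

locale braided_group = group G for G (structure) +
  fixes a b :: "'a \<Rightarrow> 'a \<Rightarrow> 'a"
  assumes a_closed [simp]: "x \<in> carrier G \<Longrightarrow> y \<in> carrier G \<Longrightarrow> a x y \<in> carrier G"
    and b_closed [simp]: "x \<in> carrier G \<Longrightarrow> y \<in> carrier G \<Longrightarrow> b x y \<in> carrier G"
    and a_one_left [simp]: "x \<in> carrier G \<Longrightarrow> a \<one> x = x"
    and b_one_left [simp]: "x \<in> carrier G \<Longrightarrow> b \<one> x = \<one>"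
    and a_one_right [simp]: "x \<in> carrier G \<Longrightarrow> a x \<one> = \<one>"
    and b_one_right [simp]: "x \<in> carrier G \<Longrightarrow> b x \<one> = x"
    and a_mult_right: "x \<in> carrier G \<Longrightarrow> y \<in> carrier G \<Longrightarrow> z \<in> carrier G \<Longrightarrow>
      a x (y \<otimes> z) = a x y \<otimes> a (b x y) z"
    and b_mult_right: "x \<in> carrier G \<Longrightarrow> y \<in> carrier G \<Longrightarrow> z \<in> carrier G \<Longrightarrow>
      b x (y \<otimes> z) = b (b x y) z"
    and a_mult_left: "x \<in> carrier G \<Longrightarrow> y \<in> carrier G \<Longrightarrow> z \<in> carrier G \<Longrightarrow>
      a (x \<otimes> y) z = a x (a y z)"
    and b_mult_left: "x \<in> carrier G \<Longrightarrow> y \<in> carrier G \<Longrightarrow> z \<in> carrier G \<Longrightarrow>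
      b (x \<otimes> y) z = b x (a y z) \<otimes> b y z"
begin

text \<open>The bicrossed, or Zappa-Szep, product of \<open>G\<close> with itself:
  \<open>(f, h)\<close> stands for \<open>i f j h\<close>, and the exchange rule is applied to the
  inner factors \<open>h\<close> and \<open>f'\<close>.\<close>

definition bicrossed :: "('a \<times> 'a) monoid" where
  "bicrossed = \<lparr>carrier = carrier G \<times> carrier G,
     monoid.mult = (\<lambda>(f, h) (f', h'). (f \<otimes> a h f', b h f' \<otimes> h')), monoid.one = (\<one>, \<one>)\<rparr>"

lemma bicrossed_carrier [simp]: "carrier bicrossed = carrier G \<times> carrier G"
  and bicrossed_mult [simp]: "(f, h) \<otimes>\<^bsub>bicrossed\<^esub> (f', h') = (f \<otimes> a h f', b h f' \<otimes> h')"
  and bicrossed_one [simp]: "\<one>\<^bsub>bicrossed\<^esub> = (\<one>, \<one>)"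
  by (simp_all add: bicrossed_def)

lemma bicrossed_group: "group bicrossed"
proof (rule groupI)
  fix x assume "x \<in> carrier bicrossed"
  then obtain f h where x: "x = (f, h)" and [simp]: "f \<in> carrier G" "h \<in> carrier G" by auto
  \<comment> \<open>The inverse of \<open>i f j h\<close> is \<open>j (inv h) i (inv f)\<close>; the
    exchange rule puts it into this form.\<close>
  let ?y = "(a (inv h) (inv f), b (inv h) (inv f))"
  have "?y \<otimes>\<^bsub>bicrossed\<^esub> x = (\<one>, \<one>)"
    by (simp add: x flip: a_mult_right b_mult_right)
  then show "\<exists>y\<in>carrier bicrossed. y \<otimes>\<^bsub>bicrossed\<^esub> x = \<one>\<^bsub>bicrossed\<^esub>"
    by (intro bexI[of _ ?y]) simp_all
qed (auto simp: a_mult_right b_mult_right a_mult_left b_mult_left m_assoc)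

text \<open>Every pair splits as \<open>(f, h) = (f, \<one>) (\<one>, h)\<close>, and its
  coordinates determine the two factors.\<close>

lemma bicrossed_matched:
  "self_matched_pair G bicrossed (\<lambda>f. (f, \<one>)) (\<lambda>h. (\<one>, h))" (is "self_matched_pair G _ ?i ?j")
proof -
  interpret P: group bicrossed by (rule bicrossed_group)
  have i: "?i \<in> hom G bicrossed" and j: "?j \<in> hom G bicrossed"
    by (auto simp: hom_def)
  then interpret i: group_hom G bicrossed ?i + j: group_hom G bicrossed ?j
    by (unfold_locales) auto
  have "\<exists>!p. p \<in> ?i ` carrier G \<times> ?j ` carrier G \<and> x = fst p \<otimes>\<^bsub>bicrossed\<^esub> snd p"
    if "x \<in> carrier bicrossed" for x
    using that by (intro ex1I[of _ "(?i (fst x), ?j (snd x))"]) auto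
  then show ?thesis
    using i j i.img_is_subgroup j.img_is_subgroup bicrossed_group
    by (auto simp: self_matched_pair_def matched_pair_def inj_on_def)
qed

sublocale M: matched_group G bicrossed "\<lambda>f. (f, \<one>)" "\<lambda>h. (\<one>, h)"
  by unfold_locales (rule bicrossed_matched)

text \<open>In the bicrossed product \<open>(\<one>, f) (g, \<one>) = (a f g, b f g)\<close>, which
  is the exchange rule.\<close>

lemma bicrossed_operator:
  "matched_pair_operator G bicrossed (\<lambda>f. (f, \<one>)) (\<lambda>h. (\<one>, h)) =
   (\<lambda>(f, g) \<in> carrier G \<times> carrier G. (a f g, b f g))"
proof -
  have "M.al f g = a f g" "M.be f g = b f g" if "f \<in> carrier G" "g \<in> carrier G" for f g
    using that M.exchange_eqI[of f g "a f g" "b f g"] by simp_all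
  then show ?thesis by (auto simp: matched_pair_operator_def fun_eq_iff restrict_def)
qed

end

lemma braided_groupI:
  assumes "group G" and R: "R \<in> carrier G \<times> carrier G \<rightarrow> carrier G \<times> carrier G"
    and id: "braiding_identities G R"
  shows "braided_group G (\<lambda>x y. fst (R (x, y))) (\<lambda>x y. snd (R (x, y)))"
proof -
  have R': "fst (R (x, y)) \<in> carrier G" "snd (R (x, y)) \<in> carrier G"
    if "x \<in> carrier G" "y \<in> carrier G" for x y
    using R that by (auto simp: Pi_iff mem_Times_iff)
  have unit: "R (\<one>\<^bsub>G\<^esub>, x) = (x, \<one>\<^bsub>G\<^esub>)" "R (x, \<one>\<^bsub>G\<^esub>) = (\<one>\<^bsub>G\<^esub>, x)" if "x \<in> carrier G" for x
    using id that by (auto simp: braiding_identities_def)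
  have mult: "R (x, y \<otimes>\<^bsub>G\<^esub> z) =
      (fst (R (x, y)) \<otimes>\<^bsub>G\<^esub> fst (R (snd (R (x, y)), z)), snd (R (snd (R (x, y)), z)))"
    "R (x \<otimes>\<^bsub>G\<^esub> y, z) =
      (fst (R (x, fst (R (y, z)))), snd (R (x, fst (R (y, z)))) \<otimes>\<^bsub>G\<^esub> snd (R (y, z)))"
    if "x \<in> carrier G" "y \<in> carrier G" "z \<in> carrier G" for x y z
  proof -
    have "R (mult23 G (x, y, z)) = mult12 G (on23 R (on12 R (x, y, z)))"
      "R (mult12 G (x, y, z)) = mult23 G (on12 R (on23 R (x, y, z)))"
      using id that unfolding braiding_identities_def by blast+
    then show "R (x, y \<otimes>\<^bsub>G\<^esub> z) =
      (fst (R (x, y)) \<otimes>\<^bsub>G\<^esub> fst (R (snd (R (x, y)), z)), snd (R (snd (R (x, y)), z)))"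
      "R (x \<otimes>\<^bsub>G\<^esub> y, z) =
      (fst (R (x, fst (R (y, z)))), snd (R (x, fst (R (y, z)))) \<otimes>\<^bsub>G\<^esub> snd (R (y, z)))"
      by (auto simp: mult12_def mult23_def on12_def on23_def split: prod.splits)
  qed
  show ?thesis
    unfolding braided_group_def braided_group_axioms_def
    using \<open>group G\<close> by (intro conjI allI impI) (simp_all add: R' unit mult)
qed

text \<open>Since the operator is extensional, its coordinates on the carrier recover it as a HOL
  function.\<close>

lemma braided_structureD:
  assumes "group G" "braided_structure G R"
  shows "braided_group G (\<lambda>x y. fst (R (x, y))) (\<lambda>x y. snd (R (x, y)))"
    and "R = (\<lambda>(x, y) \<in> carrier G \<times> carrier G. (fst (R (x, y)), snd (R (x, y))))"
proof -
  have "R \<in> extensional (carrier G \<times> carrier G)"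
    and R: "R \<in> carrier G \<times> carrier G \<rightarrow> carrier G \<times> carrier G"
    using assms(2) unfolding braided_structure_def yang_baxter_operator_def
    by (simp_all add: bij_betw_imp_funcset)
  then show "R = (\<lambda>(x, y) \<in> carrier G \<times> carrier G. (fst (R (x, y)), snd (R (x, y))))"
    by (simp add: case_prod_beta extensional_restrict)
  show "braided_group G (\<lambda>x y. fst (R (x, y))) (\<lambda>x y. snd (R (x, y)))"
    using braided_groupI[OF assms(1) R] assms(2) by (simp add: braided_structure_def)
qed

lemma (in braided_group) braiding_identities_operator:
  "braiding_identities G (\<lambda>(x, y) \<in> carrier G \<times> carrier G. (a x y, b x y))"
  using M.operator_braiding by (simp only: bicrossed_operator)

text \<open>Bijectivity is hard to see from the laws for \<open>a\<close> and \<open>b\<close>, but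
  the map is the operator of a matched pair, for which it is known.\<close>

lemma (in braided_group) bij_betw_operator:
  "bij_betw (\<lambda>(x, y) \<in> carrier G \<times> carrier G. (a x y, b x y))
    (carrier G \<times> carrier G) (carrier G \<times> carrier G)"
  using M.operator_bij by (simp only: bicrossed_operator)

section \<open>From quasi-commutative structures to bijective cocycles\<close>

locale quasi_commutative_group = braided_group +
  assumes ab_mult: "x \<in> carrier G \<Longrightarrow> y \<in> carrier G \<Longrightarrow> a x y \<otimes> b x y = x \<otimes> y"
begin

lemma a_eq: "x \<in> carrier G \<Longrightarrow> y \<in> carrier G \<Longrightarrow> a x y = x \<otimes> y \<otimes> inv (b x y)"
  by (simp add: inv_solve_right ab_mult)

text \<open>Both sides of the equation agree in the first and the third coordinate by the braiding
  identities, and they have the same product because \<open>\<mu> R = \<mu>\<close>.\<close>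

lemma yang_baxter:
  assumes [simp]: "x \<in> carrier G" "y \<in> carrier G" "z \<in> carrier G"
  shows "a (a x y) (a (b x y) z) = a x (a y z)"
    and "b (a x y) (a (b x y) z) = a (b x (a y z)) (b y z)"
    and "b (b x y) z = b (b x (a y z)) (b y z)"
proof -
  \<comment> \<open>Both sides equal \<open>a (x \<otimes> y) z\<close>, because
    \<open>a x y \<otimes> b x y = x \<otimes> y\<close>.\<close>
  show 1: "a (a x y) (a (b x y) z) = a x (a y z)"
    by (simp add: ab_mult flip: a_mult_left)
  \<comment> \<open>Likewise both sides equal \<open>b x (y \<otimes> z)\<close>.\<close>
  show 3: "b (b x y) z = b (b x (a y z)) (b y z)"
    by (simp add: ab_mult flip: b_mult_right)
  have "a x (a y z) \<otimes> b (a x y) (a (b x y) z) = a x y \<otimes> a (b x y) z"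
    unfolding 1[symmetric] by (rule ab_mult) simp_all
  then have "a x (a y z) \<otimes> b (a x y) (a (b x y) z) \<otimes> b (b x y) z = a x y \<otimes> (b x y \<otimes> z)"
    by (simp add: m_assoc ab_mult)
  also have "\<dots> = x \<otimes> y \<otimes> z"
    by (simp add: ab_mult flip: m_assoc)
  also have "\<dots> = x \<otimes> (a y z \<otimes> b y z)"
    by (simp add: ab_mult m_assoc)
  also have "\<dots> = a x (a y z) \<otimes> b x (a y z) \<otimes> b y z"
    by (simp add: ab_mult[of x "a y z"] flip: m_assoc)
  \<comment> \<open>The last factor is written as \<open>b (b x y) z\<close>, so that both outer
    factors match those at the start of the chain and cancel.\<close>
  also have "\<dots> = a x (a y z) \<otimes> a (b x (a y z)) (b y z) \<otimes> b (b x y) z"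
    unfolding 3 by (simp add: ab_mult[of "b x (a y z)" "b y z"] m_assoc)
  finally show "b (a x y) (a (b x y) z) = a (b x (a y z)) (b y z)"
    by simp
qed

lemma quasi_commutative_operator:
  "quasi_commutative_structure G (\<lambda>(x, y) \<in> carrier G \<times> carrier G. (a x y, b x y))"
  using braiding_identities_operator bij_betw_operator
  by (auto simp: quasi_commutative_structure_def braided_structure_def yang_baxter_operator_def
      yang_baxter_equation_def on12_def on23_def ab_mult intro!: yang_baxter)

text \<open>The multiplication is forced: put \<open>u = f\<^sup>g\<close> and \<open>v = g\<close> in the cocycle identity for the identity map.\<close>

definition cocycle_group :: "'a monoid" where
  "cocycle_group = \<lparr>carrier = carrier G, monoid.mult = (\<lambda>u v. b u (inv v) \<otimes> v), monoid.one = \<one>\<rparr>"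

lemma cocycle_group_carrier [simp]: "carrier cocycle_group = carrier G"
  and cocycle_group_mult [simp]: "u \<otimes>\<^bsub>cocycle_group\<^esub> v = b u (inv v) \<otimes> v"
  and cocycle_group_one [simp]: "\<one>\<^bsub>cocycle_group\<^esub> = \<one>"
  by (simp_all add: cocycle_group_def)

text \<open>This is \<open>b_mult_left\<close> for the product of \<open>b u (inv v)\<close> and
  \<open>v\<close>: the left factor becomes \<open>b u (inv v \<otimes> a v g)\<close>, and
  \<open>inv v \<otimes> a v g = g \<otimes> inv (b v g)\<close> since
  \<open>a v g \<otimes> b v g = v \<otimes> g\<close>.\<close>

lemma b_hom:
  assumes [simp]: "u \<in> carrier G" "v \<in> carrier G" "g \<in> carrier G"
  shows "b (b u (inv v) \<otimes> v) g = b (b u g) (inv (b v g)) \<otimes> b v g"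
proof -
  have "inv v \<otimes> a v g = g \<otimes> inv (b v g)"
    by (simp add: a_eq m_assoc inv_solve_left')
  then show ?thesis
    by (simp add: b_mult_left flip: b_mult_right)
qed

lemma cocycle_group_group: "group cocycle_group"
proof (rule groupI)
  fix x assume "x \<in> carrier cocycle_group"
  then show "\<exists>y\<in>carrier cocycle_group. y \<otimes>\<^bsub>cocycle_group\<^esub> x = \<one>\<^bsub>cocycle_group\<^esub>"
    \<comment> \<open>The equation \<open>b y (inv x) \<otimes> x = \<one>\<close> says that
      \<open>b y (inv x) = inv x\<close>; acting by \<open>x\<close> gives the witness.\<close>
    by (intro bexI[of _ "b (inv x) x"]) (simp_all flip: b_mult_right)
next
  fix x y z assume "x \<in> carrier cocycle_group" "y \<in> carrier cocycle_group" "z \<in> carrier cocycle_group"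
  \<comment> \<open>Associativity comes from \<open>b_hom\<close> for the action of
    \<open>inv z\<close>.\<close>
  then show "x \<otimes>\<^bsub>cocycle_group\<^esub> y \<otimes>\<^bsub>cocycle_group\<^esub> z = x \<otimes>\<^bsub>cocycle_group\<^esub> (y \<otimes>\<^bsub>cocycle_group\<^esub> z)"
    by (simp add: b_hom inv_mult_group b_mult_right m_assoc)
qed auto

text \<open>The action of \<open>g\<close> is undone by that of \<open>inv g\<close>, and the
  cocycle identity reduces to \<open>b (b f g) (inv g) = f\<close>.\<close>

lemma cocycle_group_bijective: "bijective_cocycle G cocycle_group b (\<lambda>x. x)"
proof -
  have "bij_betw (\<lambda>u. b u g) (carrier G) (carrier G)" if "g \<in> carrier G" for g
    using that by (intro bij_betw_byWitness[where f' = "\<lambda>u. b u (inv g)"]) (auto simp flip: b_mult_right)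
  then have "right_automorphism_action G cocycle_group b"
    by (auto simp: right_automorphism_action_def iso_def hom_def b_hom b_mult_right)
  moreover have "one_cocycle G cocycle_group b (\<lambda>x. x)"
    by (auto simp: one_cocycle_def simp flip: b_mult_right)
  ultimately show ?thesis
    by (simp add: bijective_cocycle_def cocycle_group_group bij_betw_def)
qed

text \<open>For the identity cocycle \<open>cocycle_psi\<close> is \<open>b\<close>, and
  \<open>a_eq\<close> supplies the first coordinate.\<close>

lemma cocycle_group_operator:
  "cocycle_operator G b (\<lambda>x. x) = (\<lambda>(x, y) \<in> carrier G \<times> carrier G. (a x y, b x y))"
  by (auto simp: cocycle_operator_def cocycle_psi_def fun_eq_iff restrict_def a_eq
      inv_into_f_f[of "\<lambda>x. x" _ "b _ _"])

end

section \<open>Bijective cocycles and their operators\<close>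

locale bijective_cocycle_group = group G for G (structure) +
  fixes K :: "('k, 'c) monoid_scheme" and act \<phi>
  assumes bijective: "bijective_cocycle G K act \<phi>"
begin

abbreviation "psi \<equiv> cocycle_psi G act \<phi>"
abbreviation "alp f g \<equiv> f \<otimes> g \<otimes> inv (psi f g)"

sublocale K: group K
  using bijective by (simp add: bijective_cocycle_def)

lemma phi_bij: "bij_betw \<phi> (carrier G) (carrier K)"
  using bijective by (simp add: bijective_cocycle_def)

lemma phi_closed [simp]: "g \<in> carrier G \<Longrightarrow> \<phi> g \<in> carrier K"
  using phi_bij by (auto simp: bij_betw_def)

lemma phi_eq_iff: "f \<in> carrier G \<Longrightarrow> g \<in> carrier G \<Longrightarrow> \<phi> f = \<phi> g \<longleftrightarrow> f = g"
  using phi_bij by (auto simp: bij_betw_def inj_on_eq_iff)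

lemma act_closed [simp]: "u \<in> carrier K \<Longrightarrow> g \<in> carrier G \<Longrightarrow> act u g \<in> carrier K"
  and act_mult: "u \<in> carrier K \<Longrightarrow> v \<in> carrier K \<Longrightarrow> g \<in> carrier G \<Longrightarrow>
    act (u \<otimes>\<^bsub>K\<^esub> v) g = act u g \<otimes>\<^bsub>K\<^esub> act v g"
  and act_one [simp]: "u \<in> carrier K \<Longrightarrow> act u \<one> = u"
  and act_act: "u \<in> carrier K \<Longrightarrow> f \<in> carrier G \<Longrightarrow> g \<in> carrier G \<Longrightarrow>
    act (act u f) g = act u (f \<otimes> g)"
  and phi_mult: "f \<in> carrier G \<Longrightarrow> g \<in> carrier G \<Longrightarrow> \<phi> (f \<otimes> g) = act (\<phi> f) g \<otimes>\<^bsub>K\<^esub> \<phi> g"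
  using bijective
  by (auto simp: bijective_cocycle_def right_automorphism_action_def one_cocycle_def iso_def hom_def)

lemma phi_one [simp]: "\<phi> \<one> = \<one>\<^bsub>K\<^esub>"
  using phi_mult[of \<one> \<one>] by simp

lemma act_unit [simp]: "g \<in> carrier G \<Longrightarrow> act \<one>\<^bsub>K\<^esub> g = \<one>\<^bsub>K\<^esub>"
  using act_mult[of "\<one>\<^bsub>K\<^esub>" "\<one>\<^bsub>K\<^esub>" g] by simp

lemma psi_closed [simp]: "f \<in> carrier G \<Longrightarrow> g \<in> carrier G \<Longrightarrow> psi f g \<in> carrier G"
  and phi_psi: "f \<in> carrier G \<Longrightarrow> g \<in> carrier G \<Longrightarrow> \<phi> (psi f g) = act (\<phi> f) g"
  using phi_bij unfolding cocycle_psi_def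
  by (metis act_closed phi_closed bij_betw_imp_surj_on inv_into_into f_inv_into_f)+

text \<open>Injectivity of \<open>\<phi>\<close> allows equations for \<open>psi\<close> to be
  checked after applying \<open>\<phi>\<close>, where the action and cocycle laws are
  available.\<close>

lemma psi_eqI:
  assumes "f \<in> carrier G" "g \<in> carrier G" "h \<in> carrier G" "act (\<phi> f) g = \<phi> h"
  shows "psi f g = h"
  using assms phi_psi[of f g] phi_eq_iff[of "psi f g" h] by simp

lemma alp_psi: "f \<in> carrier G \<Longrightarrow> g \<in> carrier G \<Longrightarrow> alp f g \<otimes> psi f g = f \<otimes> g"
  by (simp add: m_assoc)

text \<open>The laws for \<open>psi\<close> come from the action and the cocycle identity by way of
  \<open>\<phi>\<close>; those for \<open>alp\<close> then follow by computing in
  \<open>G\<close>.\<close>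

lemma quasi_commutative: "quasi_commutative_group G alp psi"
proof -
  have 1: "psi \<one> x = \<one>" "psi x \<one> = x" if "x \<in> carrier G" for x
    using that by (auto intro!: psi_eqI)
  have 2: "psi x (y \<otimes> z) = psi (psi x y) z"
    if "x \<in> carrier G" "y \<in> carrier G" "z \<in> carrier G" for x y z
    using that by (auto intro!: psi_eqI simp: phi_psi act_act)
  \<comment> \<open>Acting by \<open>z\<close> on \<open>\<phi> (x \<otimes> y)\<close> gives the
    product of \<open>act (\<phi> x) (y \<otimes> z)\<close> and \<open>act (\<phi> y) z\<close> in
    \<open>K\<close>. Replacing \<open>y \<otimes> z\<close> by
    \<open>alp y z \<otimes> psi y z\<close> makes this \<open>\<phi>\<close> of the right-hand
    side.\<close>
  have 3: "psi (x \<otimes> y) z = psi x (alp y z) \<otimes> psi y z"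
    if [simp]: "x \<in> carrier G" "y \<in> carrier G" "z \<in> carrier G" for x y z
    by (rule psi_eqI)
      (simp_all add: phi_mult phi_psi act_act act_mult alp_psi)
  \<comment> \<open>On the right the inner factors \<open>inv (psi x y)\<close> and
    \<open>psi x y\<close> cancel.\<close>
  have 4: "alp x (y \<otimes> z) = alp x y \<otimes> alp (psi x y) z"
    if [simp]: "x \<in> carrier G" "y \<in> carrier G" "z \<in> carrier G" for x y z
    by (simp add: 2 m_assoc flip: m_assoc[of "inv (psi x y)" "psi x y"])
  have 5: "alp (x \<otimes> y) z = alp x (alp y z)"
    if [simp]: "x \<in> carrier G" "y \<in> carrier G" "z \<in> carrier G" for x y z
    by (simp add: 3 inv_mult_group m_assoc)
  show ?thesis
    by unfold_locales ((rule 2 3 4 5 alp_psi; assumption) | simp add: 1)+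
qed

sublocale Q: quasi_commutative_group G alp psi
  by (rule quasi_commutative)

lemma cocycle_operator_apply:
  "f \<in> carrier G \<Longrightarrow> g \<in> carrier G \<Longrightarrow> cocycle_operator G act \<phi> (f, g) = (alp f g, psi f g)"
  by (simp add: cocycle_operator_def)

lemma cocycle_operator_quasi_commutative:
  "quasi_commutative_structure G (cocycle_operator G act \<phi>)"
  using Q.quasi_commutative_operator by (simp add: cocycle_operator_def)

text \<open>With \<open>R(f, g) = (f', g')\<close>, applying \<open>\<phi>\<close> to \<open>f' g' = f g\<close> shows that \<open>\<phi>(f')\<close> acted on by \<open>g'\<close> is the
  conjugate of \<open>\<phi>(g)\<close> by \<open>\<phi>(f)\<^sup>g\<close>; so \<open>R\<^sup>2 = I\<close> at \<open>(f, g)\<close> says that these two commute.\<close>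

lemma act_alp:
  assumes [simp]: "f \<in> carrier G" "g \<in> carrier G"
  shows "act (\<phi> (alp f g)) (psi f g) \<otimes>\<^bsub>K\<^esub> act (\<phi> f) g = act (\<phi> f) g \<otimes>\<^bsub>K\<^esub> \<phi> g"
  using phi_mult[of "alp f g" "psi f g"] by (simp add: alp_psi phi_psi phi_mult)

lemma operator_involutive_at_iff:
  assumes [simp]: "f \<in> carrier G" "g \<in> carrier G"
  shows "cocycle_operator G act \<phi> (cocycle_operator G act \<phi> (f, g)) = (f, g) \<longleftrightarrow>
    \<phi> g \<otimes>\<^bsub>K\<^esub> act (\<phi> f) g = act (\<phi> f) g \<otimes>\<^bsub>K\<^esub> \<phi> g"
proof -
  \<comment> \<open>Since the product of the coordinates is preserved, the first coordinate returns
    to \<open>f\<close> once the second returns to \<open>g\<close>.\<close>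
  have "cocycle_operator G act \<phi> (cocycle_operator G act \<phi> (f, g)) = (f, g) \<longleftrightarrow>
    psi (alp f g) (psi f g) = g"
    by (auto simp: cocycle_operator_apply alp_psi) (simp add: m_assoc)
  also have "\<dots> \<longleftrightarrow> act (\<phi> (alp f g)) (psi f g) = \<phi> g"
    by (simp add: phi_psi flip: phi_eq_iff)
  \<comment> \<open>Multiply on the right by \<open>act (\<phi> f) g\<close> and apply
    \<open>act_alp\<close>.\<close>
  also have "\<dots> \<longleftrightarrow> \<phi> g \<otimes>\<^bsub>K\<^esub> act (\<phi> f) g = act (\<phi> f) g \<otimes>\<^bsub>K\<^esub> \<phi> g"
    by (simp flip: act_alp) (metis K.r_cancel act_closed assms phi_closed Q.a_closed psi_closed)
  finally show ?thesis .
qed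

text \<open>Involutivity says that \<open>act (\<phi> f) g\<close> and \<open>\<phi> g\<close>
  commute for all \<open>f\<close> and \<open>g\<close>. Every pair \<open>u\<close>,
  \<open>v\<close> in \<open>K\<close> is of this form: choose \<open>g\<close> with
  \<open>\<phi> g = v\<close>, then \<open>f\<close> with
  \<open>\<phi> f = act u (inv g)\<close>.\<close>

lemma operator_involutive_iff:
  "involutive_operator (carrier G) (cocycle_operator G act \<phi>) \<longleftrightarrow> comm_group K"
proof
  assume inv: "involutive_operator (carrier G) (cocycle_operator G act \<phi>)"
  show "comm_group K"
  proof (rule K.group_comm_groupI)
    fix u v assume u: "u \<in> carrier K" and v: "v \<in> carrier K"
    obtain g where g: "g \<in> carrier G" "v = \<phi> g"
      using v phi_bij by (auto simp: bij_betw_def)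
    obtain f where f: "f \<in> carrier G" "act u (inv g) = \<phi> f"
      using act_closed[OF u inv_closed[OF g(1)]] phi_bij by (auto simp: bij_betw_def)
    have "act (\<phi> f) g = u"
      using u g f by (simp add: act_act flip: f(2))
    then show "u \<otimes>\<^bsub>K\<^esub> v = v \<otimes>\<^bsub>K\<^esub> u"
      using operator_involutive_at_iff[of f g] inv f g by (simp add: involutive_operator_def)
  qed
next
  assume "comm_group K"
  then interpret K: comm_group K .
  show "involutive_operator (carrier G) (cocycle_operator G act \<phi>)"
    by (auto simp: involutive_operator_def operator_involutive_at_iff intro: K.m_comm)
qed

end

section \<open>Isomorphisms of bijective cocycles\<close>

text \<open>The operator determines \<open>psi\<close>, which is the action carried to
  \<open>G\<close> by \<open>\<phi>\<close>. The cocycle identity then determines the multiplication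
  of \<open>K\<close>, so \<open>\<phi> g \<mapsto> \<phi>' g\<close> is an isomorphism.\<close>

lemma cocycle_operator_eq_iff:
  assumes "group G" "bijective_cocycle G K act \<phi>" "bijective_cocycle G L act' \<phi>'"
  shows "cocycle_operator G act \<phi> = cocycle_operator G act' \<phi>' \<longleftrightarrow>
    cocycle_iso G K act \<phi> L act' \<phi>'"
proof -
  interpret K: bijective_cocycle_group G K act \<phi>
    using assms by (simp add: bijective_cocycle_group_def bijective_cocycle_group_axioms_def)
  interpret L: bijective_cocycle_group G L act' \<phi>'
    using assms by (simp add: bijective_cocycle_group_def bijective_cocycle_group_axioms_def)
  show ?thesis
  proof
    assume eq: "cocycle_operator G act \<phi> = cocycle_operator G act' \<phi>'"
    have psi: "K.psi f g = L.psi f g" if "f \<in> carrier G" "g \<in> carrier G" for f g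
      using K.cocycle_operator_apply[OF that] L.cocycle_operator_apply[OF that] eq by auto
    define T where "T = \<phi>' \<circ> inv_into (carrier G) \<phi>"
    have T: "T (\<phi> g) = \<phi>' g" if "g \<in> carrier G" for g
      using that K.phi_bij by (simp add: T_def bij_betw_def)
    have T_bij: "bij_betw T (carrier K) (carrier L)"
      unfolding T_def by (rule bij_betw_trans[OF bij_betw_inv_into[OF K.phi_bij] L.phi_bij])
    have T_act: "T (act u g) = act' (T u) g" if "u \<in> carrier K" "g \<in> carrier G" for u g
    proof -
      obtain f where f: "f \<in> carrier G" "u = \<phi> f"
        using \<open>u \<in> carrier K\<close> K.phi_bij by (auto simp: bij_betw_def)
      then have "T (act u g) = \<phi>' (K.psi f g)"
        using that by (simp add: T flip: K.phi_psi)
      then show ?thesis using f that by (simp add: psi T L.phi_psi)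
    qed
    have "T (u \<otimes>\<^bsub>K\<^esub> v) = T u \<otimes>\<^bsub>L\<^esub> T v" if u: "u \<in> carrier K" and v: "v \<in> carrier K" for u v
    proof -
      \<comment> \<open>With \<open>v = \<phi> g\<close> and \<open>u = act (\<phi> f) g\<close>,
        the product of \<open>u\<close> and \<open>v\<close> is the single value
        \<open>\<phi> (f \<otimes> g)\<close>.\<close>
      obtain g where g [simp]: "g \<in> carrier G" "v = \<phi> g"
        using v K.phi_bij by (auto simp: bij_betw_def)
      obtain f where f: "f \<in> carrier G" "act u (inv\<^bsub>G\<^esub> g) = \<phi> f"
        using K.act_closed[OF u K.inv_closed[OF g(1)]] K.phi_bij by (auto simp: bij_betw_def)
      have act: "act (\<phi> f) g = u"
        using u f by (simp add: K.act_act flip: f(2))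
      have "T (u \<otimes>\<^bsub>K\<^esub> v) = T (\<phi> (f \<otimes>\<^bsub>G\<^esub> g))"
        using f by (simp add: K.phi_mult act)
      also have "\<dots> = act' (T (\<phi> f)) g \<otimes>\<^bsub>L\<^esub> T v"
        using f by (simp add: T L.phi_mult)
      also have "act' (T (\<phi> f)) g = T u"
        using f by (simp add: act flip: T_act)
      finally show ?thesis .
    qed
    then have "T \<in> iso K L"
      using T_bij by (auto simp: iso_def hom_def bij_betw_def)
    then show "cocycle_iso G K act \<phi> L act' \<phi>'"
      using T T_act unfolding cocycle_iso_def by blast
  next
    assume "cocycle_iso G K act \<phi> L act' \<phi>'"
    then obtain T where T_act: "\<And>u g. u \<in> carrier K \<Longrightarrow> g \<in> carrier G \<Longrightarrow> T (act u g) = act' (T u) g"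
      and T: "\<And>g. g \<in> carrier G \<Longrightarrow> T (\<phi> g) = \<phi>' g"
      by (auto simp: cocycle_iso_def)
    \<comment> \<open>\<open>T\<close> carries the equation \<open>phi_psi\<close> for
      \<open>K\<close> to the one that characterizes \<open>L.psi\<close>.\<close>
    have "L.psi f g = K.psi f g" if [simp]: "f \<in> carrier G" "g \<in> carrier G" for f g
      by (rule L.psi_eqI) (simp_all add: K.phi_psi T_act flip: T)
    then show "cocycle_operator G act \<phi> = cocycle_operator G act' \<phi>'"
      by (auto simp: cocycle_operator_def fun_eq_iff restrict_def)
  qed
qed

lemma quasi_commutative_groupI:
  assumes "group G" "quasi_commutative_structure G R"
  shows "quasi_commutative_group G (\<lambda>x y. fst (R (x, y))) (\<lambda>x y. snd (R (x, y)))"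
  using assms braided_structureD(1)[of G R]
  by (simp add: quasi_commutative_structure_def quasi_commutative_group_def
      quasi_commutative_group_axioms_def)

text \<open>A correspondence means here that the data define an operator, that every structure
  arises from such data, and that two data have the same operator exactly when they are isomorphic
  over \<open>G\<close>. For matched pairs the Yang-Baxter equation is the condition that singles
  out those giving braided structures. The realizing groups live on \<open>'a \<times> 'a\<close>
  and on \<open>'a\<close>.\<close>

theorem theorem5p0p8:
  fixes G :: "('a, 'b) monoid_scheme"
  assumes "group G"
  shows
    "((\<forall>(P :: 'p monoid) i j. self_matched_pair G P i j \<longrightarrow>
         bij_betw (matched_pair_operator G P i j)
           (carrier G \<times> carrier G) (carrier G \<times> carrier G) \<and>
         braiding_identities G (matched_pair_operator G P i j) \<and>
         (braided_structure G (matched_pair_operator G P i j) \<longleftrightarrow>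
          yang_baxter_equation (carrier G) (matched_pair_operator G P i j))) \<and>
      (\<forall>R. braided_structure G R \<longrightarrow>
         (\<exists>(P :: ('a \<times> 'a) monoid) i j.
            self_matched_pair G P i j \<and> R = matched_pair_operator G P i j)) \<and>
      (\<forall>(P :: 'p monoid) i j (Q :: 'q monoid) k l.
         self_matched_pair G P i j \<and> self_matched_pair G Q k l \<longrightarrow>
         (matched_pair_operator G P i j = matched_pair_operator G Q k l \<longleftrightarrow>
          self_matched_pair_iso G P i j Q k l))) \<and>
     ((\<forall>(K :: 'k monoid) act \<phi>. bijective_cocycle G K act \<phi> \<longrightarrow>
         quasi_commutative_structure G (cocycle_operator G act \<phi>)) \<and>
      (\<forall>R. quasi_commutative_structure G R \<longrightarrow>
         (\<exists>(K :: 'a monoid) act \<phi>.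
            bijective_cocycle G K act \<phi> \<and> R = cocycle_operator G act \<phi>)) \<and>
      (\<forall>(K :: 'k monoid) act \<phi> (L :: 'l monoid) act' \<phi>'.
         bijective_cocycle G K act \<phi> \<and> bijective_cocycle G L act' \<phi>' \<longrightarrow>
         (cocycle_operator G act \<phi> = cocycle_operator G act' \<phi>' \<longleftrightarrow>
          cocycle_iso G K act \<phi> L act' \<phi>'))) \<and>
     (\<forall>(K :: 'k monoid) act \<phi>. bijective_cocycle G K act \<phi> \<longrightarrow>
         (involutive_operator (carrier G) (cocycle_operator G act \<phi>) \<longleftrightarrow> comm_group K) \<and>
         (nearly_commutative_structure G (cocycle_operator G act \<phi>) \<longleftrightarrow> comm_group K))"
proof -
  have mg: "matched_group G P i j" if "self_matched_pair G P i j"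
    for P :: "('r, 's) monoid_scheme" and i j
    using that assms by (simp add: matched_group_def matched_group_axioms_def)
  have cg: "bijective_cocycle_group G K act \<phi>" if "bijective_cocycle G K act \<phi>"
    for K :: "('r, 's) monoid_scheme" and act \<phi>
    using that assms by (simp add: bijective_cocycle_group_def bijective_cocycle_group_axioms_def)
  have braided: "\<exists>(P :: ('a \<times> 'a) monoid) i j. self_matched_pair G P i j \<and> R = matched_pair_operator G P i j"
    if "braided_structure G R" for R
  proof -
    interpret braided_group G "\<lambda>x y. fst (R (x, y))" "\<lambda>x y. snd (R (x, y))"
      by (rule braided_structureD[OF assms that])
    have "R = matched_pair_operator G bicrossed (\<lambda>f. (f, \<one>\<^bsub>G\<^esub>)) (\<lambda>h. (\<one>\<^bsub>G\<^esub>, h))"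
      unfolding bicrossed_operator by (rule braided_structureD[OF assms that])
    then show ?thesis using bicrossed_matched by blast
  qed
  have quasi: "\<exists>(K :: 'a monoid) act \<phi>. bijective_cocycle G K act \<phi> \<and> R = cocycle_operator G act \<phi>"
    if "quasi_commutative_structure G R" for R
  proof -
    interpret quasi_commutative_group G "\<lambda>x y. fst (R (x, y))" "\<lambda>x y. snd (R (x, y))"
      by (rule quasi_commutative_groupI[OF assms that])
    have "R = cocycle_operator G (\<lambda>x y. snd (R (x, y))) (\<lambda>x. x)"
      unfolding cocycle_group_operator
      using that braided_structureD(2)[OF assms] unfolding quasi_commutative_structure_def by blast
    then show ?thesis using cocycle_group_bijective by blast
  qed
  note quasi_commutative = cg[THEN bijective_cocycle_group.cocycle_operator_quasi_commutative]
  note involutive = cg[THEN bijective_cocycle_group.operator_involutive_iff]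
  show ?thesis
    apply (intro conjI allI impI)
             apply (erule mg[THEN matched_group.operator_bij])
            apply (erule mg[THEN matched_group.operator_braiding])
           apply (erule mg[THEN matched_group.operator_braided_iff])
          apply (erule braided)
         apply (erule conjE, rule iffI; erule (2) self_matched_pair_isoI[OF assms] self_matched_pair_isoD[OF assms])
        apply (erule quasi_commutative)
       apply (erule quasi)
      apply (erule conjE, erule (1) cocycle_operator_eq_iff[OF assms])
     apply (erule involutive)
    apply (simp add: nearly_commutative_structure_def quasi_commutative involutive)
    done
qed

end
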